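(* Let $I_{\mathbb{X}}$ be the defining ideal of a set $\mathbb{X}$ of $s$ points in $\mathbb{P}^{n_1}\times\cdots\times\mathbb{P}^{n_k}$ in generic position, let $\mathcal{D}=\min\{\underline{i}\in\mathbb{N}^k\mid N(\underline{i})>s\}$, and set $\mathcal{T}=\mathcal{D}\cup\left(\bigcup_{l=1}^k(\mathcal{D}+e_l)\right)$. If $f$ is a generator of $I_{\mathbb{X}}$, then $\deg f\in\mathcal{T}$. In particular, $$I_{\mathbb{X}}=\Big\langle\bigoplus_{\underline{i}\in\mathcal{T}}(I_{\mathbb{X}})_{\underline{i}}\Big\rangle .$$
   Context: $\mathbf{k}$ is an algebraically closed field of characteristic $0$; $\mathbb{N}=\{0,1,2,\ldots\}$; $k\ge 1$ and $n_1,\ldots,n_k\ge 1$ are integers; $e_1,\ldots,e_k$ is the standard basis of $\mathbb{N}^k$; $\mathbb{N}^k$ is partially ordered coordinatewise, and $\min\mathcal{S}$ denotes the set of minimal elements of $\mathcal{S}\subseteq\mathbb{N}^k$. For $E\subseteq\mathbb{N}^k$ and $\underline{i}\in\mathbb{N}^k$, $E+\underline{i}=\{\underline{j}+\underline{i}\mid\underline{j}\in E\}$. $R=\mathbf{k}[x_{l,m} : 1\le l\le k,\ 0\le m\le n_l]$ is $\mathbb{N}^k$-graded by $\deg x_{l,m}=e_l$; it is the coordinate ring of $\mathbb{P}^{n_1}\times\cdots\times\mathbb{P}^{n_k}$ over $\mathbf{k}$. $N(\underline{i})=\dim_{\mathbf{k}}R_{\underline{i}}=\prod_{l=1}^k\binom{n_l+i_l}{i_l}$.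 For a nonempty finite set $\mathbb{X}$ of points, $I_{\mathbb{X}}\subseteq R$ is the ideal generated by the $\mathbb{N}^k$-homogeneous forms vanishing at every point of $\mathbb{X}$, and $H_{\mathbb{X}}(\underline{i})=\dim_{\mathbf{k}}(R/I_{\mathbb{X}})_{\underline{i}}$. A set $\mathbb{X}$ of $s$ (distinct) points is in generic position if $H_{\mathbb{X}}(\underline{i})=\min\{N(\underline{i}),s\}$ for all $\underline{i}\in\mathbb{N}^k$. A generator of $I_{\mathbb{X}}$ means a minimal homogeneous generator, i.e. a homogeneous $f\in(I_{\mathbb{X}})_{\underline{j}}$ (some $\underline{j}$) not belonging to $\sum_{m=1}^kR_{e_m}(I_{\mathbb{X}})_{\underline{j}-e_m}$, where $R_{e_m}(I_{\mathbb{X}})_{\underline{i}}=\{f_0x_{m,0}+\cdots+f_{n_m}x_{m,n_m}\mid f_h\in (I_{\mathbb{X}})_{\underline{i}}\}$ (and is $0$ if $\underline{i}\notin\mathbb{N}^k$). *)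

theory Defs
  imports
    "HOL-Library.Poly_Mapping"
    "HOL-Computational_Algebra.Polynomial"
    "HOL-Algebra.Ideal"
    "HOL-Algebra.QuotRing"
    "HOL-Algebra.Embedded_Algebras"
begin

text \<open>
  The factors of \<open>\<P>\<^bsup>n\<^sub>1\<^esup> \<times> \<dots> \<times> \<P>\<^bsup>n\<^sub>k\<^esup>\<close> are indexed by a finite type \<open>'k\<close> (so \<open>k = CARD('k) \<ge> 1\<close>),
  and \<open>\<nat>\<^sup>k\<close> is the type \<open>'k \<Rightarrow> nat\<close> with its pointwise order. The pair \<open>(l, m)\<close> stands for the
  variable \<open>x\<^bsub>l,m\<^esub>\<close>. A polynomial is a finitely supported function from exponent vectors to
  coefficients; \<open>+\<close> and \<open>*\<close> on this type are polynomial addition and multiplication.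
\<close>

type_synonym ('k, 'a) mpoly = "(('k \<times> nat) \<Rightarrow>\<^sub>0 nat) \<Rightarrow>\<^sub>0 'a"

definition vars :: "('k \<Rightarrow> nat) \<Rightarrow> ('k \<times> nat) set"
  where "vars n = {(l, m). m \<le> n l}"

definition mpolys :: "('k \<Rightarrow> nat) \<Rightarrow> ('k, 'a::field) mpoly set"
  where "mpolys n = {f. \<forall>t\<in>Poly_Mapping.keys f. Poly_Mapping.keys t \<subseteq> vars n}"

definition mpoly_ring :: "('k \<Rightarrow> nat) \<Rightarrow> ('k, 'a::field) mpoly ring"
  where "mpoly_ring n = \<lparr>carrier = mpolys n, mult = (*), one = 1, zero = 0, add = (+)\<rparr>"

definition Var :: "'k \<times> nat \<Rightarrow> ('k, 'a::field) mpoly"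
  where "Var v = Poly_Mapping.single (Poly_Mapping.single v 1) 1"

definition Const :: "'a::field \<Rightarrow> ('k, 'a) mpoly"
  where "Const c = Poly_Mapping.single 0 c"

definition eval_mpoly :: "('k \<times> nat \<Rightarrow> 'a::field) \<Rightarrow> ('k, 'a) mpoly \<Rightarrow> 'a"
  where "eval_mpoly a f =
    (\<Sum>t\<in>Poly_Mapping.keys f.
      Poly_Mapping.lookup f t * (\<Prod>v\<in>Poly_Mapping.keys t. a v ^ Poly_Mapping.lookup t v))"

definition multideg :: "(('k \<times> nat) \<Rightarrow>\<^sub>0 nat) \<Rightarrow> 'k \<Rightarrow> nat"
  where "multideg t = (\<lambda>l. \<Sum>v\<in>{v \<in> Poly_Mapping.keys t. fst v = l}. Poly_Mapping.lookup t v)"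

text \<open>The graded piece \<open>R\<^sub>i\<close>; it contains \<open>0\<close> for every \<open>i\<close>.\<close>

definition forms :: "('k \<Rightarrow> nat) \<Rightarrow> ('k \<Rightarrow> nat) \<Rightarrow> ('k, 'a::field) mpoly set"
  where "forms n i = {f \<in> mpolys n. \<forall>t\<in>Poly_Mapping.keys f. multideg t = i}"

definition dimN :: "('k::finite \<Rightarrow> nat) \<Rightarrow> ('k \<Rightarrow> nat) \<Rightarrow> nat"
  where "dimN n i = (\<Prod>l\<in>UNIV. (n l + i l) choose (i l))"

text \<open>
  Points of projective space are the classes of nonzero vectors \<open>(v 0, \<dots>, v d)\<close> modulo nonzero
  scalars; a vector is padded by zeros to a function on \<open>nat\<close>.
\<close>

definition nonzero_vecs :: "nat \<Rightarrow> (nat \<Rightarrow> 'a::field) set"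
  where "nonzero_vecs d = {v. (\<forall>m>d. v m = 0) \<and> (\<exists>m\<le>d. v m \<noteq> 0)}"

definition proportional :: "nat \<Rightarrow> ((nat \<Rightarrow> 'a::field) \<times> (nat \<Rightarrow> 'a)) set"
  where "proportional d =
    {(v, w) \<in> nonzero_vecs d \<times> nonzero_vecs d. \<exists>c. c \<noteq> 0 \<and> w = (\<lambda>m. c * v m)}"

definition proj_space :: "nat \<Rightarrow> (nat \<Rightarrow> 'a::field) set set"
  where "proj_space d = nonzero_vecs d // proportional d"

definition multiproj_space :: "('k \<Rightarrow> nat) \<Rightarrow> ('k \<Rightarrow> (nat \<Rightarrow> 'a::field) set) set"
  where "multiproj_space n = {P. \<forall>l. P l \<in> proj_space (n l)}"

definition vanishes_at :: "('k, 'a::field) mpoly \<Rightarrow> ('k \<Rightarrow> (nat \<Rightarrow> 'a) set) \<Rightarrow> bool"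
  where "vanishes_at f P \<longleftrightarrow> (\<forall>a. (\<forall>l. a l \<in> P l) \<longrightarrow> eval_mpoly (\<lambda>(l, m). a l m) f = 0)"

definition vanishing_ideal ::
    "('k \<Rightarrow> nat) \<Rightarrow> ('k \<Rightarrow> (nat \<Rightarrow> 'a::field) set) set \<Rightarrow> ('k, 'a) mpoly set"
  where "vanishing_ideal n X =
    Idl\<^bsub>mpoly_ring n\<^esub> {f. (\<exists>j. f \<in> forms n j) \<and> (\<forall>P\<in>X. vanishes_at f P)}"

definition ideal_piece ::
    "('k \<Rightarrow> nat) \<Rightarrow> ('k \<Rightarrow> (nat \<Rightarrow> 'a::field) set) set \<Rightarrow> ('k \<Rightarrow> nat) \<Rightarrow> ('k, 'a) mpoly set"
  where "ideal_piece n X i = vanishing_ideal n X \<inter> forms n i"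

text \<open>
  \<open>H\<^sub>X(i)\<close> is the dimension of the image of \<open>R\<^sub>i\<close> in the quotient ring, over the image of the
  constants in it.
\<close>

definition hilbert ::
    "('k \<Rightarrow> nat) \<Rightarrow> ('k \<Rightarrow> (nat \<Rightarrow> 'a::field) set) set \<Rightarrow> ('k \<Rightarrow> nat) \<Rightarrow> nat"
  where "hilbert n X i =
    (let R = mpoly_ring n; I = vanishing_ideal n X; proj = (\<lambda>f. I +>\<^bsub>R\<^esub> f)
     in THE d. ring.dimension (R Quot I) d (proj ` range Const) (proj ` forms n i))"

definition generic_position ::
    "('k::finite \<Rightarrow> nat) \<Rightarrow> ('k \<Rightarrow> (nat \<Rightarrow> 'a::field) set) set \<Rightarrow> bool"
  where "generic_position n X \<longleftrightarrow> (\<forall>i. hilbert n X i = min (dimN n i) (card X))"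

text \<open>
  \<open>linear_multiples n X m j\<close> is the space \<open>R\<^bsub>e\<^sub>m\<^esub>(I\<^sub>X)\<^bsub>j - e\<^sub>m\<^esub>\<close>, indexed by the degree \<open>j\<close> of its elements.
  The case distinction is needed because subtraction on \<open>nat\<close> truncates.
\<close>

definition linear_multiples ::
    "('k \<Rightarrow> nat) \<Rightarrow> ('k \<Rightarrow> (nat \<Rightarrow> 'a::field) set) set \<Rightarrow> 'k \<Rightarrow> ('k \<Rightarrow> nat) \<Rightarrow> ('k, 'a) mpoly set"
  where "linear_multiples n X m j =
    (if j m = 0 then {0}
     else {\<Sum>h\<le>n m. f h * Var (m, h) | f. \<forall>h\<le>n m. f h \<in> ideal_piece n X (j(m := j m - 1))})"

text \<open>\<open>f\<close> is a minimal homogeneous generator of \<open>I\<^sub>X\<close>, of degree \<open>j\<close>; such an \<open>f\<close> is never \<open>0\<close>.\<close>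

definition is_generator ::
    "('k::finite \<Rightarrow> nat) \<Rightarrow> ('k \<Rightarrow> (nat \<Rightarrow> 'a::field) set) set \<Rightarrow> ('k, 'a) mpoly \<Rightarrow> ('k \<Rightarrow> nat) \<Rightarrow> bool"
  where "is_generator n X f j \<longleftrightarrow>
    f \<in> ideal_piece n X j \<and>
    f \<notin> {\<Sum>m\<in>UNIV. g m | g. \<forall>m. g m \<in> linear_multiples n X m j}"

definition min_elements :: "('k \<Rightarrow> nat) set \<Rightarrow> ('k \<Rightarrow> nat) set"
  where "min_elements S = {i \<in> S. \<not> (\<exists>j\<in>S. j < i)}"

definition unit_vec :: "'k \<Rightarrow> 'k \<Rightarrow> nat"
  where "unit_vec l = (\<lambda>m. if m = l then 1 else 0)"

definition translate :: "('k \<Rightarrow> nat) set \<Rightarrow> ('k \<Rightarrow> nat) \<Rightarrow> ('k \<Rightarrow> nat) set"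
  where "translate E i = {\<lambda>l. j l + i l | j. j \<in> E}"

definition degD :: "('k::finite \<Rightarrow> nat) \<Rightarrow> nat \<Rightarrow> ('k \<Rightarrow> nat) set"
  where "degD n s = min_elements {i. dimN n i > s}"

definition degT :: "('k::finite \<Rightarrow> nat) \<Rightarrow> nat \<Rightarrow> ('k \<Rightarrow> nat) set"
  where "degT n s = degD n s \<union> (\<Union>l. translate (degD n s) (unit_vec l))"

text \<open>The internal direct sum of the \<open>(I\<^sub>X)\<^sub>i\<close> for \<open>i \<in> T\<close>, as a subset of \<open>R\<close>.\<close>

definition ideal_pieces_sum ::
    "('k \<Rightarrow> nat) \<Rightarrow> ('k \<Rightarrow> (nat \<Rightarrow> 'a::field) set) set \<Rightarrow> ('k \<Rightarrow> nat) set \<Rightarrow> ('k, 'a) mpoly set"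
  where "ideal_pieces_sum n X T =
    {\<Sum>i\<in>F. g i | F g. finite F \<and> F \<subseteq> T \<and> (\<forall>i\<in>F. g i \<in> ideal_piece n X i)}"

end

theory Submission
  imports Defs
begin

text \<open>
  Let \<open>L\<close> be a linear form of degree \<open>e\<^sub>m\<close> that vanishes at no point of \<open>X\<close>. Multiplication by \<open>L\<close> is
  injective on \<open>R/I\<close>, so it maps \<open>(R/I)\<^sub>i\<close> onto \<open>(R/I)\<close> in degree \<open>i + e\<^sub>m\<close> as soon as both spaces have
  dimension \<open>s\<close>, that is, as soon as \<open>N(i) \<ge> s\<close>. Now let \<open>j\<close> lie above \<open>D\<close> but outside \<open>T\<close>. Then
  \<open>j = i + e\<^sub>m + e\<^sub>l\<close> with \<open>N(i) > s\<close>. Write \<open>f \<in> I\<^sub>j\<close> as \<open>\<Sum>\<^sub>h g\<^sub>h x\<^bsub>l,h\<^esub>\<close> and \<open>g\<^sub>h = q\<^sub>h L + p\<^sub>h\<close> with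
  \<open>p\<^sub>h \<in> I\<close>. In \<open>f = L \<Sum>\<^sub>h q\<^sub>h x\<^bsub>l,h\<^esub> + \<Sum>\<^sub>h p\<^sub>h x\<^bsub>l,h\<^esub>\<close> the factor of \<open>L\<close> must lie in \<open>I\<close>, so \<open>f\<close> is not
  a generator. In the degrees \<open>j\<close> that are not above \<open>D\<close>, the equality of \<open>H(j)\<close> and \<open>N(j)\<close> gives
  \<open>I\<^sub>j = 0\<close>.
\<close>

section \<open>Polynomials\<close>

lemma sum_single_lookup:
  "(\<Sum>t\<in>Poly_Mapping.keys f. Poly_Mapping.single t (Poly_Mapping.lookup f t)) = f"
proof (rule poly_mapping_eqI)
  fix k
  show "Poly_Mapping.lookup
      (\<Sum>t\<in>Poly_Mapping.keys f. Poly_Mapping.single t (Poly_Mapping.lookup f t)) k =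
      Poly_Mapping.lookup f k"
    by (simp add: lookup_sum lookup_single when_def in_keys_iff)
qed

text \<open>A finitely supported function is a finite sum of terms \<open>single t c\<close>. The
  zero function is itself such a term, with coefficient 0 at an arbitrary key, so the rule has no
  separate zero case.\<close>

lemma poly_mapping_add_induct [case_names single add]:
  fixes f :: "'a \<Rightarrow>\<^sub>0 'b::comm_monoid_add"
  assumes single: "\<And>t c. P (Poly_Mapping.single t c)"
    and add: "\<And>f g. P f \<Longrightarrow> P g \<Longrightarrow> P (f + g)"
  shows "P f"
proof -
  have "P (\<Sum>t\<in>A. Poly_Mapping.single t (c t))" if "finite A" for A c
    using that
  proof (induction A rule: finite_induct)
    case empty
    show ?case using single[of undefined 0] by simp
  next
    case (insert x A)
    then show ?case by (simp add: single add)
  qed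
  from this[OF finite_keys] show ?thesis
    by (metis sum_single_lookup)
qed

lemma Const_zero [simp]: "Const 0 = 0"
  and Const_one [simp]: "Const 1 = 1"
  and Const_mult: "Const (a * b) = Const a * Const b"
  and Const_add: "Const (a + b) = Const a + Const b"
  and Const_uminus: "Const (- a) = - Const a"
  by (simp_all add: Const_def mult_single single_add single_uminus)

lemma inj_Const: "inj Const"
  unfolding Const_def by (rule inj_single)

section \<open>Evaluation at a point\<close>

definition eval_monom :: "('k \<times> nat \<Rightarrow> 'a::field) \<Rightarrow> (('k \<times> nat) \<Rightarrow>\<^sub>0 nat) \<Rightarrow> 'a"
  where "eval_monom a t = (\<Prod>v\<in>Poly_Mapping.keys t. a v ^ Poly_Mapping.lookup t v)"

text \<open>Extra indices contribute factors \<open>a v ^ 0 = 1\<close>. Monomials with different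
  supports can thus be compared over one common index set.\<close>

lemma eval_monom_superset:
  assumes "finite A" "Poly_Mapping.keys t \<subseteq> A"
  shows "eval_monom a t = (\<Prod>v\<in>A. a v ^ Poly_Mapping.lookup t v)"
  unfolding eval_monom_def
  by (rule prod.mono_neutral_left) (use assms in \<open>auto simp: in_keys_iff\<close>)

lemma eval_monom_zero [simp]: "eval_monom a 0 = 1"
  by (simp add: eval_monom_def)

lemma eval_monom_single [simp]: "eval_monom a (Poly_Mapping.single v (Suc 0)) = a v"
  by (simp add: eval_monom_def)

lemma eval_monom_add: "eval_monom a (s + t) = eval_monom a s * eval_monom a t"
proof -
  let ?A = "Poly_Mapping.keys s \<union> Poly_Mapping.keys t"
  have fin: "finite ?A" by simp
  show ?thesis
    unfolding eval_monom_superset[OF fin keys_add] eval_monom_superset[OF fin Un_upper1]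
      eval_monom_superset[OF fin Un_upper2] prod.distrib[symmetric]
    by (rule prod.cong) (simp_all add: lookup_add power_add)
qed

lemma eval_mpoly_alt:
  "eval_mpoly a f = (\<Sum>t\<in>Poly_Mapping.keys f. Poly_Mapping.lookup f t * eval_monom a t)"
  by (simp add: eval_mpoly_def eval_monom_def)

lemma eval_mpoly_single [simp]: "eval_mpoly a (Poly_Mapping.single t c) = c * eval_monom a t"
  by (simp add: eval_mpoly_alt)

lemma eval_mpoly_zero [simp]: "eval_mpoly a 0 = 0"
  by (simp add: eval_mpoly_alt)

lemma eval_mpoly_one [simp]: "eval_mpoly a 1 = 1"
  by (simp add: eval_mpoly_alt)

lemma eval_mpoly_Const [simp]: "eval_mpoly a (Const c) = c"
  by (simp add: Const_def)

lemma eval_mpoly_Var [simp]: "eval_mpoly a (Var v) = a v"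
  by (simp add: Var_def)

lemma eval_mpoly_add [simp]: "eval_mpoly a (f + g) = eval_mpoly a f + eval_mpoly a g"
  unfolding eval_mpoly_alt by (rule setsum_keys_plus_distrib) (simp_all add: algebra_simps)

text \<open>Both sides are additive in \<open>f\<close> and in \<open>g\<close>, so two nested
  inductions reduce the claim to a product of two monomials.\<close>

lemma eval_mpoly_mult [simp]: "eval_mpoly a (f * g) = eval_mpoly a f * eval_mpoly a g"
proof (induction f rule: poly_mapping_add_induct)
  case (single t c)
  show ?case
  proof (induction g rule: poly_mapping_add_induct)
    case (single s d)
    then show ?case by (simp add: mult_single eval_monom_add)
  qed (simp add: algebra_simps)
qed (simp add: algebra_simps)

lemma eval_mpoly_uminus [simp]: "eval_mpoly a (- f) = - eval_mpoly a f"
  using eval_mpoly_add[of a f "- f"] by (simp add: eq_neg_iff_add_eq_0 add.commute)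

lemma eval_mpoly_sum [simp]: "eval_mpoly a (sum f A) = (\<Sum>x\<in>A. eval_mpoly a (f x))"
  by (induction A rule: infinite_finite_induct) simp_all

section \<open>The multigrading and its homogeneous pieces\<close>

lemma multideg_superset:
  assumes "finite A" "Poly_Mapping.keys t \<subseteq> A"
  shows "multideg t l = (\<Sum>v\<in>{v \<in> A. fst v = l}. Poly_Mapping.lookup t v)"
  unfolding multideg_def
  by (rule sum.mono_neutral_left) (use assms in \<open>auto simp: in_keys_iff\<close>)

lemma multideg_zero [simp]: "multideg 0 l = 0"
  by (simp add: multideg_def)

lemma multideg_add: "multideg (s + t) l = multideg s l + multideg t l"
proof -
  let ?A = "Poly_Mapping.keys s \<union> Poly_Mapping.keys t"
  have fin: "finite ?A" by simp
  show ?thesis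
    unfolding multideg_superset[OF fin keys_add] multideg_superset[OF fin Un_upper1]
      multideg_superset[OF fin Un_upper2] sum.distrib[symmetric]
    by (rule sum.cong) (simp_all add: lookup_add)
qed

lemma multideg_single: "multideg (Poly_Mapping.single v d) l = (if fst v = l then d else 0)"
  by (subst multideg_superset[of "{v}"]) (auto simp: lookup_single conj_commute Collect_conv_if)

lemma mpolys_zero [simp]: "0 \<in> mpolys n"
  and mpolys_one [simp]: "1 \<in> mpolys n"
  and mpolys_Const [simp]: "Const c \<in> mpolys n"
  by (simp_all add: mpolys_def Const_def)

lemma mpolys_add [simp]: "f \<in> mpolys n \<Longrightarrow> g \<in> mpolys n \<Longrightarrow> f + g \<in> mpolys n"
  using keys_add[of f g] by (auto simp: mpolys_def)

lemma mpolys_mult [simp]: "f \<in> mpolys n \<Longrightarrow> g \<in> mpolys n \<Longrightarrow> f * g \<in> mpolys n"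
proof -
  assume f: "f \<in> mpolys n" and g: "g \<in> mpolys n"
  have "Poly_Mapping.keys t \<subseteq> vars n" if t: "t \<in> Poly_Mapping.keys (f * g)" for t
  proof -
    obtain a b where "t = a + b" "a \<in> Poly_Mapping.keys f" "b \<in> Poly_Mapping.keys g"
      using t keys_mult[of f g] by blast
    then show ?thesis using f g keys_add[of a b] by (fastforce simp: mpolys_def)
  qed
  then show ?thesis by (simp add: mpolys_def)
qed

lemma mpolys_uminus [simp]: "f \<in> mpolys n \<Longrightarrow> - f \<in> mpolys n"
  by (auto simp: mpolys_def in_keys_iff)

lemma mpolys_Var: "m \<le> n l \<Longrightarrow> Var (l, m) \<in> mpolys n"
  by (simp add: mpolys_def Var_def vars_def)

lemma forms_subset_mpolys: "forms n j \<subseteq> mpolys n"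
  by (auto simp: forms_def)

lemma forms_zero [simp]: "0 \<in> forms n j"
  by (simp add: forms_def)

lemma forms_add: "f \<in> forms n j \<Longrightarrow> g \<in> forms n j \<Longrightarrow> f + g \<in> forms n j"
  using keys_add[of f g] by (auto simp: forms_def)

lemma forms_uminus: "f \<in> forms n j \<Longrightarrow> - f \<in> forms n j"
  by (auto simp: forms_def in_keys_iff)

lemma forms_diff: "f \<in> forms n j \<Longrightarrow> g \<in> forms n j \<Longrightarrow> f - g \<in> forms n j"
  using forms_add[OF _ forms_uminus, of f n j g] by simp

lemma forms_sum: "(\<And>x. x \<in> A \<Longrightarrow> f x \<in> forms n j) \<Longrightarrow> sum f A \<in> forms n j"
  by (induction A rule: infinite_finite_induct) (auto intro: forms_add)

lemma forms_mult:
  assumes "f \<in> forms n i" "g \<in> forms n j"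
  shows "f * g \<in> forms n (\<lambda>l. i l + j l)"
proof -
  have "multideg t = (\<lambda>l. i l + j l)" if t: "t \<in> Poly_Mapping.keys (f * g)" for t
  proof -
    obtain a b where "t = a + b" "a \<in> Poly_Mapping.keys f" "b \<in> Poly_Mapping.keys g"
      using t keys_mult[of f g] by blast
    then show ?thesis using assms by (auto simp: forms_def multideg_add)
  qed
  then show ?thesis using assms by (simp add: forms_def)
qed

lemma forms_Const_mult:
  assumes "f \<in> forms n j"
  shows "Const c * f \<in> forms n j"
proof -
  have "Const c \<in> forms n (\<lambda>l. 0)"
    by (auto simp: forms_def) (auto simp: Const_def fun_eq_iff split: if_splits)
  from forms_mult[OF this assms] show ?thesis by simp
qed

lemma forms_mult_Var:
  assumes "f \<in> forms n i" "h \<le> n m"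
  shows "f * Var (m, h) \<in> forms n (i(m := Suc (i m)))"
proof -
  have "Var (m, h) \<in> forms n (unit_vec m)"
    using assms(2) by (simp add: forms_def mpolys_Var)
      (auto simp: Var_def unit_vec_def multideg_single fun_eq_iff)
  moreover have "(\<lambda>l. i l + unit_vec m l) = i(m := Suc (i m))"
    by (auto simp: unit_vec_def)
  ultimately show ?thesis using forms_mult[OF assms(1)] by metis
qed

text \<open>The degree of \<open>t\<close> in block \<open>m\<close> is positive, so some variable
  of that block divides the monomial. The quotient is the coefficient of that variable; all other
  coefficients are 0.\<close>

lemma forms_decompose_single:
  assumes "Poly_Mapping.keys t \<subseteq> vars n" "multideg t = i(m := Suc (i m))"
  shows "\<exists>g. (\<forall>h\<le>n m. g h \<in> forms n i) \<and> Poly_Mapping.single t c = (\<Sum>h\<le>n m. g h * Var (m, h))"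
proof -
  have "multideg t m \<noteq> 0" using assms(2) by simp
  then obtain v where v: "v \<in> Poly_Mapping.keys t" "fst v = m"
    unfolding multideg_def by (metis (mono_tags, lifting) mem_Collect_eq sum.neutral)
  then obtain h where h: "v = (m, h)" by (cases v) auto
  have hle: "h \<le> n m" using v assms(1) h by (auto simp: vars_def)
  define t' where "t' = t - Poly_Mapping.single v 1"
  \<comment> \<open>Truncated subtraction does no harm, because \<open>v\<close> has positive
    exponent in \<open>t\<close>.\<close>
  have t: "t = t' + Poly_Mapping.single v 1"
    using v(1) unfolding t'_def
    by (intro poly_mapping_eqI)
      (auto simp: lookup_add lookup_minus lookup_single when_def in_keys_iff)
  have "Poly_Mapping.keys t' \<subseteq> Poly_Mapping.keys t"
    unfolding t'_def by (auto simp: in_keys_iff lookup_minus)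
  moreover have "multideg t' = i"
  proof
    fix l
    have "multideg t l = multideg t' l + (if m = l then 1 else 0)"
      by (subst t) (simp add: multideg_add multideg_single v(2))
    then show "multideg t' l = i l" using assms(2) by (auto split: if_splits)
  qed
  ultimately have form: "Poly_Mapping.single t' c \<in> forms n i"
    using assms(1) by (auto simp: forms_def mpolys_def)
  define g where "g x = (if x = h then Poly_Mapping.single t' c else 0)" for x
  have "(\<Sum>x\<le>n m. g x * Var (m, x)) =
      (\<Sum>x\<le>n m. if x = h then Poly_Mapping.single t' c * Var (m, h) else 0)"
    by (rule sum.cong) (simp_all add: g_def)
  also have "\<dots> = Poly_Mapping.single t' c * Var (m, h)"
    using hle by simp
  also have "\<dots> = Poly_Mapping.single t c"
    using t h by (simp add: Var_def mult_single)
  finally show ?thesis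
    using form by (intro exI[of _ g]) (simp add: g_def)
qed

text \<open>Each term of \<open>f\<close> is divisible by a variable of block \<open>m\<close>; a
  decomposition is chosen for every term, and the coefficients of each variable are then
  collected.\<close>

lemma forms_decompose:
  assumes "f \<in> forms n (i(m := Suc (i m)))"
  shows "\<exists>g. (\<forall>h\<le>n m. g h \<in> forms n i) \<and> f = (\<Sum>h\<le>n m. g h * Var (m, h))"
proof -
  have "\<forall>t\<in>Poly_Mapping.keys f. \<exists>g. (\<forall>h\<le>n m. g h \<in> forms n i) \<and>
      Poly_Mapping.single t (Poly_Mapping.lookup f t) = (\<Sum>h\<le>n m. g h * Var (m, h))"
    by (intro ballI forms_decompose_single) (use assms in \<open>auto simp: forms_def mpolys_def\<close>)
  then obtain g where g: "\<forall>t\<in>Poly_Mapping.keys f. (\<forall>h\<le>n m. g t h \<in> forms n i) \<and>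
      Poly_Mapping.single t (Poly_Mapping.lookup f t) = (\<Sum>h\<le>n m. g t h * Var (m, h))"
    by (rule bchoice[THEN exE])
  have "f = (\<Sum>t\<in>Poly_Mapping.keys f. Poly_Mapping.single t (Poly_Mapping.lookup f t))"
    by (simp add: sum_single_lookup)
  also have "\<dots> = (\<Sum>t\<in>Poly_Mapping.keys f. \<Sum>h\<le>n m. g t h * Var (m, h))"
    by (rule sum.cong) (use g in simp_all)
  also have "\<dots> = (\<Sum>h\<le>n m. (\<Sum>t\<in>Poly_Mapping.keys f. g t h) * Var (m, h))"
    by (subst sum.swap) (simp add: sum_distrib_right)
  finally show ?thesis
    by (intro exI[of _ "\<lambda>h. \<Sum>t\<in>Poly_Mapping.keys f. g t h"]) (use g in \<open>auto intro!: forms_sum\<close>)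
qed

section \<open>The polynomial ring and its field of constants\<close>

lemma mpoly_ring_simps [simp]:
  "carrier (mpoly_ring n) = mpolys n" "x \<otimes>\<^bsub>mpoly_ring n\<^esub> y = x * y" "\<one>\<^bsub>mpoly_ring n\<^esub> = 1"
  "\<zero>\<^bsub>mpoly_ring n\<^esub> = 0" "x \<oplus>\<^bsub>mpoly_ring n\<^esub> y = x + y"
  by (simp_all add: mpoly_ring_def)

lemma mpoly_ring_cring: "cring (mpoly_ring n :: ('k, 'a::field) mpoly ring)"
proof (rule cringI)
  show "abelian_group (mpoly_ring n :: ('k, 'a) mpoly ring)"
  proof (rule abelian_groupI)
    fix x assume "x \<in> carrier (mpoly_ring n :: ('k, 'a) mpoly ring)"
    then show "\<exists>y\<in>carrier (mpoly_ring n). y \<oplus>\<^bsub>mpoly_ring n\<^esub> x = \<zero>\<^bsub>mpoly_ring n\<^esub>"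
      by (auto intro!: bexI[of _ "- x"])
  qed (simp_all add: algebra_simps)
  show "comm_monoid (mpoly_ring n :: ('k, 'a) mpoly ring)"
    by (rule comm_monoidI) (simp_all add: algebra_simps)
qed (simp_all add: algebra_simps)

lemma mpoly_ring_a_inv [simp]:
  assumes "x \<in> mpolys n"
  shows "\<ominus>\<^bsub>mpoly_ring n\<^esub> x = - x"
proof -
  interpret cring "mpoly_ring n" by (rule mpoly_ring_cring)
  show ?thesis using assms by (intro minus_equality) simp_all
qed

text \<open>\<open>Span\<close> and \<open>dimension\<close> take their scalars from a subfield of
  the ring itself, so the base field enters as the set of constant polynomials.\<close>

lemma range_Const_subfield:
  "subfield (range Const) (mpoly_ring n :: ('k, 'a::field) mpoly ring)"
proof -
  interpret cring "mpoly_ring n :: ('k, 'a) mpoly ring" by (rule mpoly_ring_cring)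
  let ?K = "range Const :: ('k, 'a) mpoly set"
  have "subring ?K (mpoly_ring n)"
  proof (rule subringI)
    show "\<one>\<^bsub>mpoly_ring n\<^esub> \<in> ?K" by (simp add: image_iff) (metis Const_one)
  qed (auto simp flip: Const_uminus Const_mult Const_add)
  then have "subcring ?K (mpoly_ring n)" by (rule subcringI')
  then show ?thesis
  proof (rule subfieldI)
    show "Units (mpoly_ring n\<lparr>carrier := ?K\<rparr>) = ?K - {\<zero>\<^bsub>mpoly_ring n\<^esub>}"
    proof (intro equalityI subsetI)
      fix f assume "f \<in> Units (mpoly_ring n\<lparr>carrier := ?K\<rparr>)"
      then have "f \<in> ?K" "\<exists>g. g * f = 1" unfolding Units_def by auto
      moreover have "f \<noteq> 0" using calculation(2) by (metis mult_zero_right zero_neq_one)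
      ultimately show "f \<in> ?K - {\<zero>\<^bsub>mpoly_ring n\<^esub>}" by simp
    next
      fix f assume f: "f \<in> ?K - {\<zero>\<^bsub>mpoly_ring n\<^esub>}"
      then obtain x where x: "f = Const x" by blast
      with f have "x \<noteq> 0" by auto
      then have "Const (inverse x) * f = 1" "f * Const (inverse x) = 1"
        unfolding x by (simp_all flip: Const_mult)
      then show "f \<in> Units (mpoly_ring n\<lparr>carrier := ?K\<rparr>)"
        using f unfolding Units_def by auto
    qed
  qed
qed

section \<open>Linear algebra over a subfield of a ring\<close>

text \<open>Going through the list from its end, a vector is kept only if it lies outside the span
  of the later ones. If nothing is dropped, the list was independent.\<close>

lemma (in ring) dependent_imp_shorter_base:
  assumes K: "subfield K R" and "set Us \<subseteq> carrier R"
  shows "\<exists>Vs. independent K Vs \<and> Span K Vs = Span K Us \<and> length Vs \<le> length Us \<and>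
    (dependent K Us \<longrightarrow> length Vs < length Us)"
  using assms(2)
proof (induction Us)
  case Nil
  show ?case by (intro exI[of _ "[]"]) simp
next
  case (Cons u Us)
  then obtain Vs where Vs: "independent K Vs" "Span K Vs = Span K Us" "length Vs \<le> length Us"
    "dependent K Us \<Longrightarrow> length Vs < length Us" by auto
  show ?case
  proof (cases "u \<in> Span K Us")
    case True
    then have "set (u # Us) \<subseteq> Span K Us"
      using Span_base_incl[OF K, of Us] Cons.prems by auto
    then have "Span K (u # Us) = Span K Us"
      using mono_Span_subset[OF K, of "u # Us" Us] mono_Span[OF K, of Us u] Cons.prems by auto
    then show ?thesis using Vs by (intro exI[of _ Vs]) auto
  next
    case False
    then have "independent K (u # Vs)"
      using Vs Cons.prems by (intro li_Cons) auto
    moreover have "independent K Us" if "length Vs = length Us"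
      using Vs(4) that by auto
    ultimately show ?thesis
      using Vs False Cons.prems by (intro exI[of _ "u # Vs"]) (auto intro: li_Cons)
  qed
qed

text \<open>Otherwise the list would shrink to a base with fewer than \<open>d\<close>
  elements.\<close>

lemma (in ring) spanning_imp_independent:
  assumes "subfield K R" "set Us \<subseteq> carrier R" "dimension d K (Span K Us)" "length Us \<le> d"
  shows "independent K Us"
proof (rule ccontr)
  assume "dependent K Us"
  then obtain Vs where "independent K Vs" "Span K Vs = Span K Us" "length Vs < length Us"
    using dependent_imp_shorter_base[OF assms(1,2)] by blast
  then have "d = length Vs"
    using dimension_is_inj[OF assms(1,3)] dimension_independent[of K Vs] by simp
  then show False using \<open>length Vs < length Us\<close> assms(4) by simp
qed

text \<open>An injective linear map between spaces of the same finite dimension is onto: the image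
  of a base of \<open>E\<close> is an independent list of length \<open>d\<close> in
  \<open>F\<close>, hence a base of \<open>F\<close>.\<close>

lemma (in ring) mult_right_surj_dimension:
  assumes K: "subfield K R" and E: "dimension d K E" and F: "dimension d K F"
    and a: "a \<in> carrier R" and maps: "\<And>x. x \<in> E \<Longrightarrow> x \<otimes> a \<in> F"
    and inj: "\<And>x. x \<in> E \<Longrightarrow> x \<otimes> a = \<zero> \<Longrightarrow> x = \<zero>"
    and y: "y \<in> F"
  shows "\<exists>x\<in>E. y = x \<otimes> a"
proof -
  obtain Us where Us: "set Us \<subseteq> carrier R" "independent K Us" "length Us = d" "Span K Us = E"
    using exists_base[OF K E] by blast
  have sub: "K \<subseteq> carrier R" by (rule subfieldE(3)[OF K])
  let ?Vs = "map (\<lambda>u. u \<otimes> a) Us"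
  have comb: "combine Ks ?Vs = combine Ks Us \<otimes> a" if "set Ks \<subseteq> K" for Ks
    using combine_l_distr[of Ks Us a] that sub Us(1) a by auto
  have mem: "combine Ks Us \<in> E" if "set Ks \<subseteq> K" for Ks
    using Span_eq_combine_set[OF K Us(1)] Us(4) that by auto
  have Vs: "set ?Vs \<subseteq> carrier R" using Us(1) a by auto
  have "independent K ?Vs"
  proof (rule trivial_combine_imp_independent[OF K Vs])
    fix Ks assume Ks: "set Ks \<subseteq> K" "combine Ks ?Vs = \<zero>"
    then have "combine Ks Us = \<zero>" using comb mem inj by metis
    then show "set (take (length ?Vs) Ks) \<subseteq> {\<zero>}"
      using independent_imp_trivial_combine[OF K Us(2) Ks(1)] by simp
  qed
  moreover have "set ?Vs \<subseteq> F"
    using Span_base_incl[OF K Us(1)] Us(4) maps by auto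
  ultimately have "Span K ?Vs = F"
    using independent_length_eq_dimension[OF K F, of ?Vs] Us(3) by simp
  then obtain Ks where "set Ks \<subseteq> K" "y = combine Ks ?Vs"
    using Span_eq_combine_set[OF K Vs] y by blast
  then show ?thesis using comb mem by metis
qed

section \<open>Counting monomials\<close>

definition monoms :: "('k \<Rightarrow> nat) \<Rightarrow> ('k \<Rightarrow> nat) \<Rightarrow> (('k \<times> nat) \<Rightarrow>\<^sub>0 nat) set"
  where "monoms n i = {t. Poly_Mapping.keys t \<subseteq> vars n \<and> multideg t = i}"

text \<open>The exponents of a monomial, read block by block, give for each \<open>l\<close> a list
  of \<open>n l + 1\<close> numbers with sum \<open>i l\<close>. This encoding is injective, and the
  binomial coefficient counts such lists.\<close>

lemma
  fixes n :: "'k::finite \<Rightarrow> nat"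
  shows finite_monoms: "finite (monoms n i)" and card_monoms_le: "card (monoms n i) \<le> dimN n i"
proof -
  let ?\<phi> = "\<lambda>(t :: ('k \<times> nat) \<Rightarrow>\<^sub>0 nat) l. map (\<lambda>m. Poly_Mapping.lookup t (l, m)) [0..<Suc (n l)]"
  let ?L = "\<lambda>l. {xs :: nat list. length xs = Suc (n l) \<and> sum_list xs = i l}"
  have cardL: "card (?L l) = (n l + i l) choose i l" for l
    using card_length_sum_list[of "Suc (n l)" "i l"] by (simp add: add.commute)
  \<comment> \<open>An infinite set has cardinality 0, whereas the binomial coefficient is
    positive.\<close>
  have finL: "finite (?L l)" for l
    using cardL[of l] by (intro card_ge_0_finite) simp
  have inj: "inj_on ?\<phi> (monoms n i)"
  proof (rule inj_onI)
    fix s t assume st: "s \<in> monoms n i" "t \<in> monoms n i" and eq: "?\<phi> s = ?\<phi> t"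
    show "s = t"
    proof (rule poly_mapping_eqI)
      fix v :: "'k \<times> nat"
      obtain l m where v: "v = (l, m)" by force
      show "Poly_Mapping.lookup s v = Poly_Mapping.lookup t v"
      proof (cases "m \<le> n l")
        case True
        then show ?thesis
          using fun_cong[OF eq, of l] unfolding v map_eq_conv set_upt by auto
      next
        case False
        then have "v \<notin> Poly_Mapping.keys s" "v \<notin> Poly_Mapping.keys t"
          using st v by (auto simp: monoms_def vars_def)
        then show ?thesis by (simp add: in_keys_iff)
      qed
    qed
  qed
  have sub: "?\<phi> ` monoms n i \<subseteq> Pi\<^sub>E UNIV ?L"
  proof -
    have "sum_list (?\<phi> t l) = i l" if t: "t \<in> monoms n i" for t l
    proof -
      have "i l = (\<Sum>v\<in>{v \<in> Poly_Mapping.keys t. fst v = l}. Poly_Mapping.lookup t v)"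
        using t by (auto simp: monoms_def multideg_def)
      also have "\<dots> = (\<Sum>v\<in>Pair l ` {0..<Suc (n l)}. Poly_Mapping.lookup t v)"
      proof (rule sum.mono_neutral_left)
        show "{v \<in> Poly_Mapping.keys t. fst v = l} \<subseteq> Pair l ` {0..<Suc (n l)}"
          using t by (auto simp: monoms_def vars_def less_Suc_eq_le)
      qed (auto simp: in_keys_iff)
      also have "\<dots> = (\<Sum>m\<in>{0..<Suc (n l)}. Poly_Mapping.lookup t (l, m))"
        by (simp add: sum.reindex inj_on_def)
      finally show ?thesis by (simp only: interv_sum_list_conv_sum_set_nat atLeastLessThan_upt)
    qed
    then show ?thesis by (auto simp del: upt_Suc)
  qed
  have finPi: "finite (Pi\<^sub>E UNIV ?L)" by (rule finite_PiE) (use finL in auto)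
  then have "finite (?\<phi> ` monoms n i)" using sub finite_subset by blast
  then show "finite (monoms n i)" using inj finite_imageD by blast
  have "card (monoms n i) = card (?\<phi> ` monoms n i)" using inj by (simp add: card_image)
  also have "\<dots> \<le> card (Pi\<^sub>E UNIV ?L)" using finPi sub by (rule card_mono)
  also have "\<dots> = dimN n i" by (simp add: card_PiE cardL dimN_def)
  finally show "card (monoms n i) \<le> dimN n i" .
qed

text \<open>By symmetry the lower index of each binomial coefficient can be taken to be the fixed
  \<open>n l\<close>, so only the upper index grows.\<close>

lemma dimN_mono: "(\<And>l. i l \<le> j l) \<Longrightarrow> dimN n i \<le> dimN n j"
  unfolding dimN_def
proof (rule prod_mono)
  fix l assume "\<And>l. i l \<le> j l"
  then have "(n l + i l) choose n l \<le> (n l + j l) choose n l" by (intro binomial_right_mono) simp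
  then show "0 \<le> (n l + i l) choose i l \<and> (n l + i l) choose i l \<le> (n l + j l) choose j l"
    by (metis binomial_symmetric add_diff_cancel_left' le_add1 zero_le)
qed

text \<open>The monomials of degree \<open>i\<close> span the graded piece. The second claim records
  the coordinates of \<open>f\<close>, its own coefficients, so that a linear relation can later be
  read as a form.\<close>

lemma forms_eq_Span:
  assumes ts: "set ts = monoms n i" "distinct ts"
  shows "forms n i = ring.Span (mpoly_ring n) (range Const)
    (map (\<lambda>t. Poly_Mapping.single t (1::'a::field)) ts)"
    (is "_ = ring.Span ?R ?K ?Us")
    and "\<And>f :: ('k, 'a) mpoly. f \<in> forms n i \<Longrightarrow> f = ring.combine (mpoly_ring n)
      (map (\<lambda>t. Const (Poly_Mapping.lookup f t)) ts) (map (\<lambda>t. Poly_Mapping.single t 1) ts)"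
proof -
  interpret cring ?R by (rule mpoly_ring_cring)
  have comb: "combine (map (\<lambda>t. Const (c t)) us) (map (\<lambda>t. Poly_Mapping.single t (1::'a)) us) =
      (\<Sum>t\<leftarrow>us. Poly_Mapping.single t (c t))" for c us
    by (induction us) (simp_all add: Const_def mult_single)
  show rep: "f = combine (map (\<lambda>t. Const (Poly_Mapping.lookup f t)) ts) ?Us"
    if f: "f \<in> forms n i" for f
  proof -
    have "f = (\<Sum>t\<in>Poly_Mapping.keys f. Poly_Mapping.single t (Poly_Mapping.lookup f t))"
      by (simp add: sum_single_lookup)
    also have "\<dots> = (\<Sum>t\<in>set ts. Poly_Mapping.single t (Poly_Mapping.lookup f t))"
    proof (rule sum.mono_neutral_left)
      show "Poly_Mapping.keys f \<subseteq> set ts"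
        using f by (auto simp: ts(1) monoms_def forms_def mpolys_def)
    qed (simp_all add: in_keys_iff)
    finally show ?thesis
      unfolding comb using ts(2) by (simp add: sum_list_distinct_conv_sum_set)
  qed
  have Us: "set ?Us \<subseteq> forms n i"
    using ts by (auto simp: forms_def mpolys_def monoms_def split: if_splits)
  then have Us': "set ?Us \<subseteq> carrier ?R"
    using forms_subset_mpolys by fastforce
  have "combine Ks Vs \<in> forms n i" if "set Ks \<subseteq> ?K" "set Vs \<subseteq> forms n i" for Ks Vs
    using that by (induction Ks Vs rule: combine.induct) (auto intro!: forms_add forms_Const_mult)
  then have "Span ?K ?Us \<subseteq> forms n i"
    unfolding Span_eq_combine_set[OF range_Const_subfield Us'] using Us by blast
  moreover have "f \<in> Span ?K ?Us" if "f \<in> forms n i" for f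
  proof -
    have "set (map (\<lambda>t. Const (Poly_Mapping.lookup f t)) ts) \<subseteq> ?K" by auto
    then show ?thesis
      unfolding Span_eq_combine_set[OF range_Const_subfield Us'] using rep[OF that] by blast
  qed
  ultimately show "forms n i = Span ?K ?Us" by blast
qed

section \<open>The vanishing ideal\<close>

lemma proj_space_representative:
  assumes "p \<in> proj_space d"
  obtains v where "v \<in> p" "v \<in> nonzero_vecs d"
    "\<And>w. w \<in> p \<Longrightarrow> \<exists>c. c \<noteq> 0 \<and> w = (\<lambda>m. c * v m)"
proof -
  obtain v where v: "v \<in> nonzero_vecs d" "p = proportional d `` {v}"
    using assms by (auto simp: proj_space_def elim: quotientE)
  have "(v, v) \<in> proportional d"
    using v(1) by (auto simp: proportional_def intro!: exI[of _ 1])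
  then show ?thesis
    using v by (intro that[of v]) (auto simp: proportional_def)
qed

text \<open>The sum is the value at \<open>t\<close> of the polynomial with coefficients
  \<open>v 0, ..., v d\<close>, which is nonzero because \<open>v\<close> is.\<close>

lemma finite_zeros_on_moment_curve:
  fixes v :: "nat \<Rightarrow> 'a::field"
  assumes "v \<in> nonzero_vecs d"
  shows "finite {t. (\<Sum>h\<le>d. t ^ h * v h) = 0}"
proof -
  define q where "q = (\<Sum>h\<le>d. Polynomial.monom (v h) h)"
  have coeff: "Polynomial.coeff q h = v h" if "h \<le> d" for h
    using that by (simp add: q_def coeff_sum)
  obtain m where "m \<le> d" "v m \<noteq> 0" using assms by (auto simp: nonzero_vecs_def)
  then have "q \<noteq> 0" using coeff[of m] by auto
  moreover have "poly q t = (\<Sum>h\<le>d. t ^ h * v h)" for t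
    by (simp add: q_def poly_sum poly_monom mult.commute)
  ultimately show ?thesis using poly_roots_finite[of q] by simp
qed

section \<open>The ideal of a finite set of points\<close>

locale multiproj_points =
  fixes n :: "'k::finite \<Rightarrow> nat" and X :: "('k \<Rightarrow> (nat \<Rightarrow> 'a::field) set) set"
  assumes points: "X \<subseteq> multiproj_space n" and fin: "finite X" and nonempty: "X \<noteq> {}"
begin

abbreviation "R \<equiv> mpoly_ring n :: ('k, 'a) mpoly ring"
abbreviation "I \<equiv> vanishing_ideal n X"
abbreviation "vanishing \<equiv> {f \<in> mpolys n. \<forall>P\<in>X. vanishes_at f P}"

sublocale cring R
  by (rule mpoly_ring_cring)

lemma ideal_vanishing: "ideal vanishing R"
proof (rule idealI)
  show "subgroup vanishing (add_monoid R)"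
    by (rule add.subgroupI) (auto simp: vanishes_at_def intro: exI[of _ 0])
qed (auto simp: vanishes_at_def ring_axioms)

lemma ideal_I: "ideal I R"
  unfolding vanishing_ideal_def by (rule genideal_ideal) (auto simp: forms_def)

lemma I_subset_vanishing: "I \<subseteq> vanishing"
  unfolding vanishing_ideal_def by (rule genideal_minimal[OF ideal_vanishing]) (auto simp: forms_def)

text \<open>Generating an ideal adds no form that fails to vanish on \<open>X\<close>, since the
  generators lie in the larger ideal of all polynomials vanishing at every representative.\<close>

lemma form_in_I_iff:
  assumes "f \<in> forms n j"
  shows "f \<in> I \<longleftrightarrow> (\<forall>P\<in>X. vanishes_at f P)"
proof
  assume "\<forall>P\<in>X. vanishes_at f P"
  then show "f \<in> I"
    unfolding vanishing_ideal_def using assms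
    by (intro subsetD[OF genideal_self]) (auto simp: forms_def)
qed (use I_subset_vanishing in auto)

lemma I_add: "f \<in> I \<Longrightarrow> g \<in> I \<Longrightarrow> f + g \<in> I"
  and I_mult: "f \<in> I \<Longrightarrow> g \<in> mpolys n \<Longrightarrow> g * f \<in> I"
  and I_zero: "0 \<in> I"
  using additive_subgroup.a_closed[OF ideal.axioms(1)[OF ideal_I], of f g]
    ideal.I_l_closed[OF ideal_I, of f g] additive_subgroup.zero_closed[OF ideal.axioms(1)[OF ideal_I]]
  by simp_all

lemma I_sum: "(\<And>x. x \<in> A \<Longrightarrow> f x \<in> I) \<Longrightarrow> sum f A \<in> I"
  by (induction A rule: infinite_finite_induct) (auto intro: I_add I_zero)

lemma exists_representative:
  assumes "P \<in> X"
  shows "\<exists>a. \<forall>l. a l \<in> P l"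
proof -
  have "P l \<in> proj_space (n l)" for l using assms points by (auto simp: multiproj_space_def)
  then have "\<exists>v. v \<in> P l" for l by (metis proj_space_representative)
  then show ?thesis by metis
qed

text \<open>The constant 1 has value 1 at a representative of any point, and \<open>X\<close> has a
  point. This makes the quotient ring nonzero.\<close>

lemma one_notin_I: "1 \<notin> I"
proof
  assume "1 \<in> I"
  then obtain P where "P \<in> X" "vanishes_at (1 :: ('k, 'a) mpoly) P"
    using I_subset_vanishing nonempty by auto
  moreover obtain a where "\<forall>l. a l \<in> P l" using exists_representative[OF \<open>P \<in> X\<close>] by blast
  ultimately show False by (auto simp: vanishes_at_def)
qed

section \<open>Linear forms that avoid the points\<close>

definition linear_form :: "'k \<Rightarrow> (nat \<Rightarrow> 'a) \<Rightarrow> ('k, 'a) mpoly"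
  where "linear_form m c = (\<Sum>h\<le>n m. Const (c h) * Var (m, h))"

text \<open>The value is required to be nonzero at every representative; the negation of
  \<open>vanishes_at\<close> would give this at one representative only, too little for
  cancellation.\<close>

definition nonvanishing :: "'k \<Rightarrow> (nat \<Rightarrow> 'a) \<Rightarrow> bool"
  where "nonvanishing m c \<longleftrightarrow> (\<forall>P\<in>X. \<forall>a. (\<forall>l. a l \<in> P l) \<longrightarrow>
    eval_mpoly (\<lambda>(l, h). a l h) (linear_form m c) \<noteq> 0)"

text \<open>The coefficients are taken on the moment curve, which meets each of the finitely many
  hyperplanes to be avoided in finitely many points.\<close>

lemma exists_nonvanishing:
  assumes "infinite (UNIV :: 'a set)"
  shows "\<exists>c. nonvanishing m c"
proof -
  have "\<exists>v. v \<in> nonzero_vecs (n m) \<and> (\<forall>w\<in>P m. \<exists>c. c \<noteq> 0 \<and> w = (\<lambda>h. c * v h))"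
    if "P \<in> X" for P
  proof -
    have "P m \<in> proj_space (n m)" using that points by (auto simp: multiproj_space_def)
    then show ?thesis by (metis proj_space_representative)
  qed
  then obtain v where v: "\<And>P. P \<in> X \<Longrightarrow> v P \<in> nonzero_vecs (n m)"
    "\<And>P w. P \<in> X \<Longrightarrow> w \<in> P m \<Longrightarrow> \<exists>c. c \<noteq> 0 \<and> w = (\<lambda>h. c * v P h)"
    by metis
  have "finite (\<Union>P\<in>X. {t. (\<Sum>h\<le>n m. t ^ h * v P h) = 0})"
    using fin v(1) by (auto intro: finite_zeros_on_moment_curve)
  then obtain t where t: "t \<notin> (\<Union>P\<in>X. {t. (\<Sum>h\<le>n m. t ^ h * v P h) = 0})"
    using ex_new_if_finite[OF assms] by blast
  have "nonvanishing m (\<lambda>h. t ^ h)"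
    unfolding nonvanishing_def
  proof (intro ballI allI impI)
    fix P a assume P: "P \<in> X" "\<forall>l. a l \<in> P l"
    then obtain c where c: "c \<noteq> 0" "a m = (\<lambda>h. c * v P h)" using v(2) by blast
    have "eval_mpoly (\<lambda>(l, h). a l h) (linear_form m (\<lambda>h. t ^ h)) = (\<Sum>h\<le>n m. t ^ h * (c * v P h))"
      by (simp add: linear_form_def c(2))
    also have "\<dots> = c * (\<Sum>h\<le>n m. t ^ h * v P h)"
      by (simp add: sum_distrib_left algebra_simps)
    finally show "eval_mpoly (\<lambda>(l, h). a l h) (linear_form m (\<lambda>h. t ^ h)) \<noteq> 0"
      using t P(1) c(1) by auto
  qed
  then show ?thesis by blast
qed

lemma linear_form_mpolys: "linear_form m c \<in> mpolys n"
proof -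
  have "(\<Sum>h\<in>A. Const (c h) * Var (m, h)) \<in> mpolys n" if "A \<subseteq> {..n m}" for A
    using finite_subset[OF that finite_atMost] that
    by (induction A rule: finite_induct) (auto simp: mpolys_Var)
  then show ?thesis by (simp add: linear_form_def)
qed

lemma forms_mult_linear_form:
  assumes "f \<in> forms n i"
  shows "f * linear_form m c \<in> forms n (i(m := Suc (i m)))"
proof -
  have "f * linear_form m c = (\<Sum>h\<le>n m. (Const (c h) * f) * Var (m, h))"
    by (simp add: linear_form_def sum_distrib_left algebra_simps)
  then show ?thesis
    using assms by (auto intro!: forms_sum forms_mult_Var forms_Const_mult)
qed

text \<open>Values lie in a field, so the factor that is nonzero at every representative can be
  cancelled pointwise; for the form \<open>f\<close>, vanishing on \<open>X\<close> is membership in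
  \<open>I\<close>.\<close>

lemma nonvanishing_cancel:
  assumes "nonvanishing m c" "f \<in> forms n i" "f * linear_form m c \<in> I"
  shows "f \<in> I"
proof -
  have "vanishes_at f P" if P: "P \<in> X" for P
    unfolding vanishes_at_def
  proof (intro allI impI)
    fix a assume a: "\<forall>l. a l \<in> P l"
    have "vanishes_at (f * linear_form m c) P" using assms(3) P I_subset_vanishing by blast
    then have "eval_mpoly (\<lambda>(l, h). a l h) f * eval_mpoly (\<lambda>(l, h). a l h) (linear_form m c) = 0"
      using a by (auto simp: vanishes_at_def)
    then show "eval_mpoly (\<lambda>(l, h). a l h) f = 0"
      using assms(1) P a by (auto simp: nonvanishing_def)
  qed
  then show ?thesis using form_in_I_iff[OF assms(2)] by blast
qed

section \<open>The Hilbert function\<close>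

abbreviation "Q \<equiv> R Quot I"
abbreviation "coset \<equiv> \<lambda>f. I +>\<^bsub>R\<^esub> f"
abbreviation "K \<equiv> coset ` range Const"

sublocale quot: ring_hom_ring R Q coset
  by (rule ideal.rcos_ring_hom_ring[OF ideal_I])

lemma coset_eq_zero_iff:
  assumes "f \<in> mpolys n"
  shows "coset f = \<zero>\<^bsub>Q\<^esub> \<longleftrightarrow> f \<in> I"
proof -
  have "\<zero>\<^bsub>Q\<^esub> = I" by (simp add: FactRing_def)
  moreover have "coset f = I \<Longrightarrow> f \<in> I"
    using ideal.rcos_const_imp_mem[OF ideal_I] assms by simp
  moreover have "f \<in> I \<Longrightarrow> coset f = I"
    using a_rcos_zero[OF ideal_I] by simp
  ultimately show ?thesis by metis
qed

lemma quot_one_neq_zero: "\<one>\<^bsub>Q\<^esub> \<noteq> \<zero>\<^bsub>Q\<^esub>"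
  using coset_eq_zero_iff[of 1] one_notin_I quot.hom_one by simp

text \<open>A homomorphism from a field to a nonzero ring is injective. Injectivity later pulls a
  vanishing scalar of the quotient back to the base field.\<close>

lemma K_subfield: "subfield K Q"
  and coset_inj_Const: "inj_on coset (range Const)"
  using quot.img_is_subfield[OF range_Const_subfield quot_one_neq_zero] by simp_all

lemma coset_forms_eq_Span:
  assumes "set ts = monoms n i" "distinct ts"
  shows "quot.S.Span K (map coset (map (\<lambda>t. Poly_Mapping.single t 1) ts)) = coset ` forms n i"
  unfolding forms_eq_Span(1)[OF assms]
proof (rule quot.Span_hom)
  show "range Const \<subseteq> carrier R" by auto
  show "set (map (\<lambda>t. Poly_Mapping.single t 1) ts) \<subseteq> carrier R"
    using assms(1) by (auto simp: monoms_def mpolys_def split: if_splits)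
qed

lemma monoms_list: obtains ts where "set ts = monoms n i" "distinct ts" "length ts \<le> dimN n i"
  using finite_distinct_list[OF finite_monoms] card_monoms_le distinct_card by metis

text \<open>The definite description in \<open>hilbert\<close> denotes an actual dimension: the
  cosets of the finitely many monomials span the space, and dimension is unique.\<close>

lemma dimension_hilbert: "quot.S.dimension (hilbert n X i) K (coset ` forms n i)"
proof -
  obtain ts where ts: "set ts = monoms n i" "distinct ts" by (rule monoms_list)
  have "set (map coset (map (\<lambda>t. Poly_Mapping.single t 1) ts)) \<subseteq> carrier Q"
    using ts(1) by (auto simp: monoms_def mpolys_def split: if_splits intro!: quot.hom_closed)
  then have "quot.S.finite_dimension K (coset ` forms n i)"
    using quot.S.Span_finite_dimension[OF K_subfield] unfolding coset_forms_eq_Span[OF ts, symmetric]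
    by blast
  then have "\<exists>!d. quot.S.dimension d K (coset ` forms n i)"
    by (rule quot.S.unique_dimension[OF K_subfield])
  from theI'[OF this] show ?thesis
    unfolding hilbert_def Let_def .
qed

text \<open>If H(i) were at least N(i), the at most N(i) cosets of monomials would span a space of
  dimension at least their number and so be independent. But \<open>f\<close> is a relation between
  them, with its coefficients as scalars, so \<open>f\<close> would be 0.\<close>

lemma nonzero_form_in_I:
  assumes f: "f \<in> forms n i" "f \<in> I" "f \<noteq> 0"
  shows "hilbert n X i < dimN n i"
proof (rule ccontr)
  assume "\<not> hilbert n X i < dimN n i"
  moreover obtain ts where ts: "set ts = monoms n i" "distinct ts" "length ts \<le> dimN n i"
    by (rule monoms_list)
  ultimately have len: "length ts \<le> hilbert n X i" by simp
  let ?Us = "map (\<lambda>t. Poly_Mapping.single t 1) ts :: ('k, 'a) mpoly list"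
  let ?Ks = "map (\<lambda>t. Const (Poly_Mapping.lookup f t)) ts :: ('k, 'a) mpoly list"
  have Us: "set ?Us \<subseteq> carrier R"
    using ts(1) by (auto simp: monoms_def mpolys_def split: if_splits)
  then have cUs: "set (map coset ?Us) \<subseteq> carrier Q"
    by (auto intro!: quot.hom_closed)
  have "quot.S.independent K (map coset ?Us)"
    by (rule quot.S.spanning_imp_independent[OF K_subfield cUs])
      (use dimension_hilbert len coset_forms_eq_Span[OF ts(1,2)] in simp_all)
  moreover have "quot.S.combine (map coset ?Ks) (map coset ?Us) = \<zero>\<^bsub>Q\<^esub>"
  proof -
    have "quot.S.combine (map coset ?Ks) (map coset ?Us) = coset (combine ?Ks ?Us)"
      by (rule quot.combine_hom) (use Us in auto)
    also have "combine ?Ks ?Us = f" using forms_eq_Span(2)[OF ts(1,2) f(1)] by simp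
    also have "coset f = \<zero>\<^bsub>Q\<^esub>" using f forms_subset_mpolys coset_eq_zero_iff by blast
    finally show ?thesis .
  qed
  moreover have "set (map coset ?Ks) \<subseteq> K" by auto
  \<comment> \<open>Both lists are indexed by \<open>ts\<close>, so \<open>take\<close> removes
    nothing.\<close>
  ultimately have zero: "set (take (length (map coset ?Us)) (map coset ?Ks)) \<subseteq> {\<zero>\<^bsub>Q\<^esub>}"
    using quot.S.independent_imp_trivial_combine[OF K_subfield] by blast
  have "Poly_Mapping.lookup f t = 0" if t: "t \<in> set ts" for t
  proof -
    have "coset (Const (Poly_Mapping.lookup f t)) = \<zero>\<^bsub>Q\<^esub>" using zero t by auto
    also have "\<dots> = coset (Const 0)" using coset_eq_zero_iff[of 0] I_zero by simp
    finally have "Const (Poly_Mapping.lookup f t) = (Const 0 :: ('k, 'a) mpoly)"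
      by (rule inj_onD[OF coset_inj_Const]) (rule rangeI)+
    then show ?thesis using inj_Const by (metis injD)
  qed
  moreover have "Poly_Mapping.keys f \<subseteq> set ts"
    using f(1) by (auto simp: ts(1) monoms_def forms_def mpolys_def)
  ultimately have "Poly_Mapping.lookup f t = 0" for t by (auto simp: in_keys_iff)
  then have "f = 0" by (intro poly_mapping_eqI) simp
  then show False using f(3) by simp
qed

text \<open>Multiplication by the linear form is injective on the degree \<open>i\<close> part of
  the quotient by cancellation; equal dimensions make it onto, so \<open>g\<close> is a multiple of
  the form modulo \<open>I\<close>.\<close>

lemma mult_linear_form_surj:
  assumes c: "nonvanishing m c"
    and eq: "hilbert n X (i(m := Suc (i m))) = hilbert n X i"
    and g: "g \<in> forms n (i(m := Suc (i m)))"
  shows "\<exists>q\<in>forms n i. g - q * linear_form m c \<in> I"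
proof -
  let ?L = "linear_form m c"
  have coset_mult: "coset (f * ?L) = coset f \<otimes>\<^bsub>Q\<^esub> coset ?L" if "f \<in> forms n i" for f
    using quot.hom_mult[of f ?L] that forms_subset_mpolys linear_form_mpolys by auto
  have "\<exists>x\<in>coset ` forms n i. coset g = x \<otimes>\<^bsub>Q\<^esub> coset ?L"
  proof (rule quot.S.mult_right_surj_dimension[OF K_subfield dimension_hilbert])
    show "quot.S.dimension (hilbert n X i) K (coset ` forms n (i(m := Suc (i m))))"
      using dimension_hilbert[of "i(m := Suc (i m))"] eq by simp
    show "coset ?L \<in> carrier Q"
      using linear_form_mpolys by (intro quot.hom_closed) simp
    fix x assume "x \<in> coset ` forms n i"
    then obtain f where f: "f \<in> forms n i" "x = coset f" by blast
    show "x \<otimes>\<^bsub>Q\<^esub> coset ?L \<in> coset ` forms n (i(m := Suc (i m)))"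
      using f forms_mult_linear_form[OF f(1), of m c] coset_mult[OF f(1)] by (metis imageI)
    assume "x \<otimes>\<^bsub>Q\<^esub> coset ?L = \<zero>\<^bsub>Q\<^esub>"
    then have "f * ?L \<in> I"
      using f coset_mult[OF f(1)] coset_eq_zero_iff[of "f * ?L"] linear_form_mpolys
        forms_subset_mpolys[of n i] by auto
    then have "f \<in> I" using nonvanishing_cancel c f(1) by blast
    then show "x = \<zero>\<^bsub>Q\<^esub>"
      using f coset_eq_zero_iff[of f] forms_subset_mpolys[of n i] by auto
  qed (use g in blast)
  then obtain q where q: "q \<in> forms n i" "coset g = coset (q * ?L)" using coset_mult by auto
  have mp: "g \<in> mpolys n" "q * ?L \<in> mpolys n"
    using subsetD[OF forms_subset_mpolys g] subsetD[OF forms_subset_mpolys q(1)] linear_form_mpolys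
    by auto
  then have "g \<ominus>\<^bsub>R\<^esub> (q * ?L) \<in> I"
    using quotient_eq_iff_same_a_r_cos[OF ideal_I, of g "q * ?L"] q(2) by simp
  then have "g - q * ?L \<in> I" using mp by (simp add: a_minus_def)
  then show ?thesis using q(1) by blast
qed

section \<open>Minimal generators\<close>

lemma ideal_piece_add: "f \<in> ideal_piece n X i \<Longrightarrow> g \<in> ideal_piece n X i \<Longrightarrow> f + g \<in> ideal_piece n X i"
  by (simp add: ideal_piece_def I_add forms_add)

lemma ideal_piece_zero: "0 \<in> ideal_piece n X i"
  by (simp add: ideal_piece_def I_zero)

lemma ideal_piece_Const_mult: "f \<in> ideal_piece n X i \<Longrightarrow> Const c * f \<in> ideal_piece n X i"
  by (simp add: ideal_piece_def I_mult forms_Const_mult)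

lemma linear_multiplesI:
  assumes "\<And>h. h \<le> n m \<Longrightarrow> f h \<in> ideal_piece n X i"
  shows "(\<Sum>h\<le>n m. f h * Var (m, h)) \<in> linear_multiples n X m (i(m := Suc (i m)))"
  using assms by (auto simp: linear_multiples_def)

lemma linear_multiples_zero: "0 \<in> linear_multiples n X m j"
  by (auto simp: linear_multiples_def ideal_piece_zero intro!: exI[of _ "\<lambda>_. 0"])

lemma linear_multiples_add:
  assumes "f \<in> linear_multiples n X m j" "g \<in> linear_multiples n X m j"
  shows "f + g \<in> linear_multiples n X m j"
proof (cases "j m = 0")
  case False
  then obtain u v where "\<forall>h\<le>n m. u h \<in> ideal_piece n X (j(m := j m - 1))" "f = (\<Sum>h\<le>n m. u h * Var (m, h))"
    "\<forall>h\<le>n m. v h \<in> ideal_piece n X (j(m := j m - 1))" "g = (\<Sum>h\<le>n m. v h * Var (m, h))"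
    using assms by (auto simp: linear_multiples_def)
  then show ?thesis
    using False
    by (auto simp: linear_multiples_def sum.distrib algebra_simps ideal_piece_add
        intro!: exI[of _ "\<lambda>h. u h + v h"])
qed (use assms in \<open>simp add: linear_multiples_def\<close>)

lemma not_generatorI:
  assumes "f \<in> linear_multiples n X l j" "g \<in> linear_multiples n X m j"
  shows "\<not> is_generator n X (f + g) j"
proof -
  \<comment> \<open>The indices \<open>l\<close> and \<open>m\<close> may coincide; adding the two
    conditionals then puts both summands into the same slot.\<close>
  define u where "u x = (if x = l then f else 0) + (if x = m then g else 0)" for x
  have "u x \<in> linear_multiples n X x j" for x
    unfolding u_def using assms by (intro linear_multiples_add) (auto simp: linear_multiples_zero)
  moreover have "f + g = (\<Sum>x\<in>UNIV. u x)"
    by (simp add: u_def sum.distrib)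
  ultimately show ?thesis unfolding is_generator_def by blast
qed

lemma not_generator_zero: "\<not> is_generator n X 0 j"
  using not_generatorI[OF linear_multiples_zero linear_multiples_zero] by simp

text \<open>A generator is a nonzero form in \<open>I\<close>. In generic position the inequality
  says N(j) > s.\<close>

lemma generator_dimN:
  assumes "is_generator n X f j"
  shows "hilbert n X j < dimN n j"
  using assms nonzero_form_in_I[of f j] not_generator_zero
  by (metis IntE ideal_piece_def is_generator_def)

text \<open>When the Hilbert function does not change from \<open>i\<close> to
  \<open>i + e_m\<close>, one further step in any direction \<open>l\<close> leads to a degree
  without generators. The nested update also covers \<open>l = m\<close>.\<close>

lemma not_generator_above_stable:
  assumes inf: "infinite (UNIV :: 'a set)"
    and eq: "hilbert n X (i(m := Suc (i m))) = hilbert n X i"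
    and j: "j = (i(m := Suc (i m)))(l := Suc ((i(m := Suc (i m))) l))"
  shows "\<not> is_generator n X f j"
proof (cases "f \<in> ideal_piece n X j")
  case True
  then have f: "f \<in> forms n j" "f \<in> I" by (auto simp: ideal_piece_def)
  obtain c where c: "nonvanishing m c" using exists_nonvanishing[OF inf] by blast
  let ?L = "linear_form m c"
  let ?im = "i(m := Suc (i m))" and ?il = "i(l := Suc (i l))"
  \<comment> \<open>The two steps commute: the multiple of \<open>?L\<close> is built from degree
    \<open>i + e_l\<close>, the remainder from degree \<open>i + e_m\<close>.\<close>
  have j': "j = ?il(m := Suc (?il m))" by (auto simp: j)
  obtain g where g: "\<forall>h\<le>n l. g h \<in> forms n ?im" "f = (\<Sum>h\<le>n l. g h * Var (l, h))"
    using forms_decompose[OF f(1)[unfolded j]] by blast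
  have "\<forall>h\<in>{..n l}. \<exists>q. q \<in> forms n i \<and> g h - q * ?L \<in> I"
    using mult_linear_form_surj[OF c eq] g(1) by blast
  then obtain q where q: "\<forall>h\<in>{..n l}. q h \<in> forms n i \<and> g h - q h * ?L \<in> I"
    by (rule bchoice[THEN exE])
  define p where "p h = g h - q h * ?L" for h
  have p: "p h \<in> ideal_piece n X ?im" if "h \<le> n l" for h
    using q g(1) that forms_mult_linear_form by (auto simp: p_def ideal_piece_def intro!: forms_diff)
  define S where "S = (\<Sum>h\<le>n l. q h * Var (l, h))"
  have S: "S \<in> forms n ?il"
    unfolding S_def using q by (auto intro!: forms_sum forms_mult_Var)
  have split: "f = S * ?L + (\<Sum>h\<le>n l. p h * Var (l, h))"
  proof -
    have "f = (\<Sum>h\<le>n l. q h * Var (l, h) * ?L + p h * Var (l, h))"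
      unfolding g(2) p_def by (rule sum.cong) (simp_all add: algebra_simps)
    then show ?thesis by (simp add: sum.distrib S_def sum_distrib_right)
  qed
  have "(\<Sum>h\<le>n l. p h * Var (l, h)) \<in> I"
  proof (rule I_sum)
    fix h assume "h \<in> {..n l}"
    then show "p h * Var (l, h) \<in> I"
      using p[of h] I_mult[of "p h" "Var (l, h)"] by (simp add: ideal_piece_def mpolys_Var mult.commute)
  qed
  \<comment> \<open>Removing the remainder, which lies in \<open>I\<close>, isolates the multiple of
    \<open>?L\<close>.\<close>
  then have "f + (- 1) * (\<Sum>h\<le>n l. p h * Var (l, h)) \<in> I"
    by (intro I_add I_mult f(2)) simp_all
  then have "S * ?L \<in> I" by (simp add: split)
  then have "S \<in> I" by (rule nonvanishing_cancel[OF c S])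
  then have "S \<in> ideal_piece n X ?il" using S by (simp add: ideal_piece_def)
  \<comment> \<open>Expanding \<open>?L\<close> in its coefficients exhibits \<open>S * ?L\<close>
    as a combination of the variables of block \<open>m\<close> with factors in the ideal.\<close>
  then have "(\<Sum>h\<le>n m. (Const (c h) * S) * Var (m, h)) \<in> linear_multiples n X m j"
    unfolding j' by (intro linear_multiplesI ideal_piece_Const_mult)
  also have "(\<Sum>h\<le>n m. (Const (c h) * S) * Var (m, h)) = S * ?L"
    by (simp add: linear_form_def sum_distrib_left algebra_simps)
  finally have 1: "S * ?L \<in> linear_multiples n X m j" .
  have 2: "(\<Sum>h\<le>n l. p h * Var (l, h)) \<in> linear_multiples n X l j"
    unfolding j by (rule linear_multiplesI) (rule p)
  show ?thesis
    unfolding split by (rule not_generatorI[OF 1 2])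
qed (simp add: is_generator_def)

text \<open>Induction on the total degree: a form of \<open>I\<close> whose degree is outside
  \<open>T\<close> is not a generator, hence is a combination of variables with coefficients in
  \<open>I\<close> of smaller total degree.\<close>

lemma vanishing_ideal_generated:
  assumes T: "\<And>f j. is_generator n X f j \<Longrightarrow> j \<in> T"
  shows "I = Idl\<^bsub>R\<^esub> (ideal_pieces_sum n X T)"
proof -
  let ?S = "ideal_pieces_sum n X T"
  have "?S \<subseteq> I"
    unfolding ideal_pieces_sum_def by (auto intro!: I_sum simp: ideal_piece_def)
  then have S: "?S \<subseteq> carrier R" using I_subset_vanishing by auto
  interpret J: ideal "Idl\<^bsub>R\<^esub> ?S" R by (rule genideal_ideal[OF S])
  \<comment> \<open>The index type stays general because sums over the directions and over the
    variables of one block both occur.\<close>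
  have J_sum: "sum f A \<in> Idl\<^bsub>R\<^esub> ?S" if "\<And>x. x \<in> A \<Longrightarrow> f x \<in> Idl\<^bsub>R\<^esub> ?S" for f and A :: "'z set"
    using that J.zero_closed J.a_closed by (induction A rule: infinite_finite_induct) auto
  have piece: "f \<in> Idl\<^bsub>R\<^esub> ?S" if "f \<in> ideal_piece n X j" for f j
    using that
  proof (induction "\<Sum>l\<in>UNIV. j l" arbitrary: f j rule: less_induct)
    case less
    show ?case
    proof (cases "j \<in> T")
      case True
      have "f = (\<Sum>i\<in>{j}. f)" by simp
      then have "f \<in> ?S"
        unfolding ideal_pieces_sum_def using True less.prems
        by (intro CollectI exI[of _ "{j}"] exI[of _ "\<lambda>_. f"]) simp
      then show ?thesis using genideal_self[OF S] by blast
    next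
      case False
      then have "\<not> is_generator n X f j" using T by blast
      then obtain g where g: "f = (\<Sum>m\<in>UNIV. g m)" "\<And>m. g m \<in> linear_multiples n X m j"
        using less.prems unfolding is_generator_def by auto
      have "g m \<in> Idl\<^bsub>R\<^esub> ?S" for m
      proof (cases "j m = 0")
        case True
        then show ?thesis using g(2)[of m] J.zero_closed by (simp add: linear_multiples_def)
      next
        case False
        then obtain u where u: "\<forall>h\<le>n m. u h \<in> ideal_piece n X (j(m := j m - 1))"
          "g m = (\<Sum>h\<le>n m. u h * Var (m, h))"
          using g(2)[of m] by (auto simp: linear_multiples_def)
        have "(\<Sum>l\<in>UNIV. (j(m := j m - 1)) l) < (\<Sum>l\<in>UNIV. j l)"
          by (rule sum_strict_mono_ex1) (use False in \<open>auto intro!: exI[of _ m]\<close>)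
        then have "u h \<in> Idl\<^bsub>R\<^esub> ?S" if "h \<le> n m" for h
          using less.hyps u(1) that by blast
        then show ?thesis
          unfolding u(2) using J.I_r_closed by (intro J_sum) (simp add: mpolys_Var)
      qed
      then show ?thesis unfolding g(1) by (intro J_sum)
    qed
  qed
  have "I \<subseteq> Idl\<^bsub>R\<^esub> ?S"
  proof (subst vanishing_ideal_def, rule genideal_minimal[OF J.ideal_axioms], rule subsetI)
    fix f assume "f \<in> {f. (\<exists>j. f \<in> forms n j) \<and> (\<forall>P\<in>X. vanishes_at f P)}"
    then show "f \<in> Idl\<^bsub>R\<^esub> ?S"
      using form_in_I_iff piece by (auto simp: ideal_piece_def)
  qed
  moreover have "Idl\<^bsub>R\<^esub> ?S \<subseteq> I"
    by (rule genideal_minimal[OF ideal_I]) fact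
  ultimately show ?thesis by blast
qed

end

section \<open>The degrees of the generators\<close>

text \<open>Passing to a strictly smaller vector lowers the sum of the coordinates, so the descent
  inside \<open>S\<close> ends at a minimal element.\<close>

lemma exists_min_element_le:
  fixes j :: "'k::finite \<Rightarrow> nat"
  assumes "j \<in> S"
  shows "\<exists>d\<in>min_elements S. d \<le> j"
  using assms
proof (induction "\<Sum>l\<in>UNIV. j l" arbitrary: j rule: less_induct)
  case less
  show ?case
  proof (cases "j \<in> min_elements S")
    case False
    then obtain i where i: "i \<in> S" "i < j" using less.prems by (auto simp: min_elements_def)
    then have le: "i l \<le> j l" for l by (auto dest: less_imp_le le_funD)
    have "\<not> j \<le> i" using i(2) by (simp add: less_le_not_le)
    then obtain l where "i l < j l" by (auto simp: le_fun_def not_le)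
    then have "(\<Sum>l\<in>UNIV. i l) < (\<Sum>l\<in>UNIV. j l)"
      using le by (intro sum_strict_mono_ex1) auto
    then obtain d where "d \<in> min_elements S" "d \<le> i" using less.hyps[of i] i(1) by blast
    moreover have "i \<le> j" using i(2) by simp
    ultimately show ?thesis by (blast intro: order_trans)
  qed auto
qed

text \<open>A coordinate where \<open>d\<close> and \<open>j\<close> differ satisfies
  \<open>d l < j l\<close>; it is positive in \<open>j\<close>, and lowering it by 1 keeps the
  vector above \<open>d\<close>.\<close>

lemma less_fun_step:
  fixes d j :: "'k \<Rightarrow> nat"
  assumes "d \<le> j" "d \<noteq> j"
  obtains i l where "j = i(l := Suc (i l))" "d \<le> i"
proof -
  obtain l where l: "d l \<noteq> j l" using assms(2) by blast
  have "d l < j l" using l le_funD[OF assms(1), of l] by simp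
  then show ?thesis
    using assms(1) by (intro that[of "j(l := j l - 1)" l]) (auto simp: le_fun_def)
qed

text \<open>Some minimal \<open>d\<close> lies below \<open>j\<close>. Since \<open>j\<close> is
  neither \<open>d\<close> nor \<open>d + e_l\<close>, two unit steps down from \<open>j\<close> are
  possible without leaving the region above \<open>d\<close>, where N exceeds \<open>s\<close> by
  monotonicity.\<close>

lemma exists_two_steps:
  fixes n :: "'k::finite \<Rightarrow> nat"
  assumes "dimN n j > s" "j \<notin> degT n s"
  obtains i l m where "j = (i(m := Suc (i m)))(l := Suc ((i(m := Suc (i m))) l))" "dimN n i > s"
proof -
  obtain d where d: "d \<in> degD n s" "d \<le> j"
    using exists_min_element_le[of j "{i. dimN n i > s}"] assms(1) by (auto simp: degD_def)
  then have "d \<noteq> j" using assms(2) by (auto simp: degT_def)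
  then obtain i l where i: "j = i(l := Suc (i l))" "d \<le> i" using d(2) by (metis less_fun_step)
  have "d \<noteq> i"
  proof
    assume "d = i"
    then have "j = (\<lambda>k. d k + unit_vec l k)" using i(1) by (auto simp: unit_vec_def)
    then have "j \<in> translate (degD n s) (unit_vec l)" using d(1) by (auto simp: translate_def)
    then show False using assms(2) by (auto simp: degT_def)
  qed
  then obtain i' m where i': "i = i'(m := Suc (i' m))" "d \<le> i'" using i(2) by (metis less_fun_step)
  have "dimN n d > s" using d(1) by (auto simp: degD_def min_elements_def)
  then have "dimN n i' > s" using dimN_mono[of d i' n] i'(2) by (auto simp: le_fun_def)
  then show ?thesis using that[of i' m l] i(1) i'(1) by simp
qed

theorem theorem3p6:
  fixes n :: "'k::finite \<Rightarrow> nat"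
    and X :: "('k \<Rightarrow> (nat \<Rightarrow> 'a::{alg_closed_field, field_char_0}) set) set"
    and s :: nat
  assumes "\<forall>l. n l \<ge> 1"
    and "X \<subseteq> multiproj_space n" and "finite X" and "X \<noteq> {}" and "card X = s"
    and "generic_position n X"
  shows "(\<forall>f j. is_generator n X f j \<longrightarrow> j \<in> degT n s) \<and>
    vanishing_ideal n X = Idl\<^bsub>mpoly_ring n\<^esub> (ideal_pieces_sum n X (degT n s))"
proof -
  interpret multiproj_points n X using assms(2-4) by unfold_locales
  have hilbert: "hilbert n X i = min (dimN n i) s" for i
    using assms(5,6) by (simp add: generic_position_def)
  have gen: "j \<in> degT n s" if f: "is_generator n X f j" for f j
  proof (rule ccontr)
    assume "j \<notin> degT n s"
    moreover have "dimN n j > s" using generator_dimN[OF f] hilbert[of j] by simp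
    ultimately obtain i l m where
      j: "j = (i(m := Suc (i m)))(l := Suc ((i(m := Suc (i m))) l))" and i: "dimN n i > s"
      by (metis exists_two_steps)
    have "dimN n i \<le> dimN n (i(m := Suc (i m)))" by (rule dimN_mono) simp
    \<comment> \<open>Both N(i) and N(i + e_m) exceed \<open>s\<close>, so both minima equal
      \<open>s\<close>.\<close>
    then have "hilbert n X (i(m := Suc (i m))) = hilbert n X i" using i by (simp add: hilbert)
    \<comment> \<open>Characteristic 0 makes the field infinite, as the choice of the linear form
      requires.\<close>
    then show False using not_generator_above_stable[OF infinite_UNIV_char_0 _ j] f by blast
  qed
  then show ?thesis using vanishing_ideal_generated by blast
qed

end
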